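(* Let $L>0$, $n\ge 1$, and let $f(\cdot;1),\dots,f(\cdot;n):\mathbb{R}^d\to\mathbb{R}$ be convex differentiable functions such that $\|\nabla f(x;i)-\nabla f(y;i)\|\le L\|x-y\|$ for all $x,y\in\mathbb{R}^d$ and $i\in\{1,\dots,n\}$. Let $F(w)=\frac1n\sum_{i=1}^n f(w;i)$. Let $E>0$ be a constant, and let $\tilde x_0\in\mathbb{R}^d$ be such that there is a minimizer $x_*$ of $F$ with $\|\tilde x_0-x_*\|\le \frac{E}{\sqrt n}$; let $\sigma_*^2=\frac1n\sum_{i=1}^n\|\nabla f(x_*;i)\|^2$. Let $T\ge 2$ be an integer, $\alpha=1+\frac1T$, $k=\frac{1}{e\,\alpha\,n^{1/4}\sqrt[3]{12}}$. Run the NASG algorithm for $T$ epochs from the initial point $\tilde y_0=\tilde x_0$, with an arbitrary permutation $\pi^{(t)}$ of $\{1,\dots,n\}$ in each epoch $t$, with momentum parameters $\gamma_t=\frac{t-1}{t+2}$ and learning rates $\eta_i^{(t)}=\frac{\eta_t}{n}>0$, where $\eta_t=\frac{k\alpha^t}{LT}\le\frac1L$. Then $$F(\tilde x_T)-F(x_* )\le \frac{4\sigma_*^2}{9Ln^{3/4}T}+\frac{2LE^2e\sqrt[3]{12}}{n^{3/4}T}.$$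
   Context: NASG (Nesterov Accelerated Shuffling Gradient) algorithm: given initial points $\tilde x_0,\tilde y_0\in\mathbb{R}^d$, parameters $\gamma_t$ and learning rates $\eta_i^{(t)}>0$, for each epoch $t=1,2,\dots,T$: set $y_0^{(t)}:=\tilde y_{t-1}$; choose a permutation $\pi^{(t)}$ of $\{1,\dots,n\}$ (deterministic or random); for $i=1,\dots,n$ set $y_i^{(t)}:=y_{i-1}^{(t)}-\eta_i^{(t)}\nabla f(y_{i-1}^{(t)};\pi^{(t)}(i))$; then set $\tilde x_t:=y_n^{(t)}$ and $\tilde y_t:=\tilde x_t+\gamma_t(\tilde x_t-\tilde x_{t-1})$. Here $e$ is Euler's number and $E$ is a real constant (not an expectation). *)

theory Defs
  imports "HOL-Analysis.Analysis" "HOL-Combinatorics.Permutations"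
begin

text \<open>\<open>g j x\<close> stands for the gradient of the \<open>j\<close>-th component function at \<open>x\<close>;
  components, inner steps and epochs are all numbered from 1.\<close>

primrec nasg_inner ::
  "(nat \<Rightarrow> 'a \<Rightarrow> 'a) \<Rightarrow> (nat \<Rightarrow> real) \<Rightarrow> (nat \<Rightarrow> nat) \<Rightarrow> 'a \<Rightarrow> nat \<Rightarrow> 'a::real_vector"
where
  "nasg_inner g \<eta> \<pi> y 0 = y"
| "nasg_inner g \<eta> \<pi> y (Suc i) =
     nasg_inner g \<eta> \<pi> y i - \<eta> (Suc i) *\<^sub>R g (\<pi> (Suc i)) (nasg_inner g \<eta> \<pi> y i)"

text \<open>The state after epoch \<open>t\<close> is the pair of outer iterates (written with a tilde
  in the literature). The learning rate of inner step \<open>i\<close> of epoch \<open>t\<close> is \<open>\<eta> t i\<close>.\<close>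

primrec nasg ::
  "nat \<Rightarrow> (nat \<Rightarrow> 'a \<Rightarrow> 'a) \<Rightarrow> (nat \<Rightarrow> real) \<Rightarrow> (nat \<Rightarrow> nat \<Rightarrow> real) \<Rightarrow> (nat \<Rightarrow> nat \<Rightarrow> nat)
     \<Rightarrow> 'a \<Rightarrow> 'a \<Rightarrow> nat \<Rightarrow> 'a \<times> 'a::real_vector"
where
  "nasg n g \<gamma> \<eta> \<pi> x0 y0 0 = (x0, y0)"
| "nasg n g \<gamma> \<eta> \<pi> x0 y0 (Suc t) =
     (let (x, y) = nasg n g \<gamma> \<eta> \<pi> x0 y0 t;
          x' = nasg_inner g (\<eta> (Suc t)) (\<pi> (Suc t)) y n
      in (x', x' + \<gamma> (Suc t) *\<^sub>R (x' - x)))"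

definition nasg_x ::
  "nat \<Rightarrow> (nat \<Rightarrow> 'a \<Rightarrow> 'a) \<Rightarrow> (nat \<Rightarrow> real) \<Rightarrow> (nat \<Rightarrow> nat \<Rightarrow> real) \<Rightarrow> (nat \<Rightarrow> nat \<Rightarrow> nat)
     \<Rightarrow> 'a \<Rightarrow> 'a \<Rightarrow> nat \<Rightarrow> 'a::real_vector"
where
  "nasg_x n g \<gamma> \<eta> \<pi> x0 y0 t = fst (nasg n g \<gamma> \<eta> \<pi> x0 y0 t)"

end

theory Submission
  imports Defs
begin

text \<open>An epoch is a step of Nesterov's method with an inexact gradient, whose error at step size
  \<open>h\<close> has squared norm at most \<open>8 (L h)\<^sup>2 (\<sigma>\<^sup>2 + B)\<close>, where \<open>B\<close> is the mean of
  \<open>\<parallel>\<nabla>f(y; i) - \<nabla>f(x\<^sub>*; i)\<parallel>\<^sup>2\<close> at the starting point \<open>y\<close> of the epoch. The term \<open>B\<close> is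
  absorbed by co-coercivity of the component gradients. The error is paired with the distance from
  the auxiliary Nesterov point to \<open>x\<^sub>*\<close>; Young's inequality then multiplies the squared distance by
  \<open>\<alpha>\<close> in each epoch, which the growth \<open>\<eta>\<^sub>t = \<alpha> \<eta>\<^sub>t\<^sub>-\<^sub>1\<close> of the
  learning rates compensates, so that the Nesterov potential telescopes after division by \<open>\<alpha>\<^sup>t\<close>.
  Since \<open>\<alpha>\<^sup>T \<le> e\<close>, the weights remain bounded.\<close>

section \<open>Smoothness and convexity inequalities for gradients\<close>

lemma GDERIV_line:
  assumes "GDERIV f (u + s *\<^sub>R d) :> D"
  shows "((\<lambda>s. f (u + s *\<^sub>R d)) has_real_derivative D \<bullet> d) (at s)"
proof -
  have "((\<lambda>s. u + s *\<^sub>R d) has_derivative (\<lambda>h. h *\<^sub>R d)) (at s)"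
    by (auto intro!: derivative_eq_intros)
  from diff_chain_at[OF this assms[unfolded gderiv_def]]
  show ?thesis
    by (simp add: has_field_derivative_def o_def inner_commute)
      (simp add: mult_commute_abs)
qed

text \<open>The descent lemma, without integration: along the segment from \<open>u\<close> to
  \<open>z\<close> the quadratic upper model is subtracted from \<open>f\<close>. By Cauchy-Schwarz
  and the Lipschitz bound the difference \<open>h\<close> has nonpositive derivative.\<close>

lemma lipschitz_gradient_upper:
  fixes f :: "'a::real_inner \<Rightarrow> real"
  assumes grad: "\<And>x. GDERIV f x :> g x"
    and lip: "\<And>x y. norm (g x - g y) \<le> L * norm (x - y)"
  shows "f z \<le> f u + g u \<bullet> (z - u) + L / 2 * (norm (z - u))\<^sup>2"
proof -
  define d where "d = z - u"
  define h where "h s = f (u + s *\<^sub>R d) - s * (g u \<bullet> d) - s\<^sup>2 * (L / 2 * (norm d)\<^sup>2)" for s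
  have "h 1 \<le> h 0"
  proof (rule DERIV_nonpos_imp_nonincreasing[of 0 1 h])
    fix s :: real
    assume s: "0 \<le> s" "s \<le> 1"
    have "(h has_real_derivative
        g (u + s *\<^sub>R d) \<bullet> d - g u \<bullet> d - 2 * s * (L / 2 * (norm d)\<^sup>2)) (at s)"
      unfolding h_def by (auto intro!: derivative_eq_intros GDERIV_line grad)
    moreover have "(g (u + s *\<^sub>R d) - g u) \<bullet> d \<le> L * norm (s *\<^sub>R d) * norm d"
      by (rule order_trans[OF norm_cauchy_schwarz])
        (use lip[of "u + s *\<^sub>R d" u] in \<open>simp add: mult_right_mono\<close>)
    then have "g (u + s *\<^sub>R d) \<bullet> d - g u \<bullet> d - 2 * s * (L / 2 * (norm d)\<^sup>2) \<le> 0"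
      using s by (simp add: inner_diff_left power2_eq_square mult_ac)
    ultimately show "\<exists>y. (h has_real_derivative y) (at s) \<and> y \<le> 0" by blast
  qed simp
  then show ?thesis by (simp add: h_def d_def)
qed

text \<open>Restricting \<open>f\<close> to the line through \<open>u\<close> and \<open>z\<close>
  reduces the claim to the tangent bound for a convex function of one real variable.\<close>

lemma convex_gradient_lower:
  fixes f :: "'a::real_inner \<Rightarrow> real"
  assumes "convex_on UNIV f" and grad: "GDERIV f u :> D"
  shows "f z \<ge> f u + D \<bullet> (z - u)"
proof -
  let ?h = "\<lambda>s. f (u + s *\<^sub>R (z - u))"
  have "convex_on UNIV ?h"
  proof (rule convex_onI)
    fix t x y :: real
    assume "0 < t" "t < 1"
    have "u + ((1 - t) *\<^sub>R x + t *\<^sub>R y) *\<^sub>R (z - u)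
        = (1 - t) *\<^sub>R (u + x *\<^sub>R (z - u)) + t *\<^sub>R (u + y *\<^sub>R (z - u))"
      by (simp add: algebra_simps)
    then show "?h ((1 - t) *\<^sub>R x + t *\<^sub>R y) \<le> (1 - t) * ?h x + t * ?h y"
      using convex_onD[OF assms(1), of t] \<open>0 < t\<close> \<open>t < 1\<close> by auto
  qed simp
  moreover have "(?h has_real_derivative D \<bullet> (z - u)) (at 0)"
    by (rule GDERIV_line) (simp add: grad)
  ultimately have "?h 1 - ?h 0 \<ge> (D \<bullet> (z - u)) * (1 - 0)"
    by (intro convex_on_imp_above_tangent[where A = UNIV]) auto
  then show ?thesis by simp
qed

text \<open>A co-coercivity bound: the tangent at \<open>y\<close> bounds \<open>f z\<close> from
  below, the descent lemma at \<open>u\<close> bounds it from above, and a good choice of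
  \<open>z\<close> leaves the squared gradient difference as a gain.\<close>

lemma convex_lipschitz_gradient_lower:
  fixes f :: "'a::real_inner \<Rightarrow> real"
  assumes "L > 0" and conv: "convex_on UNIV f" and grad: "\<And>x. GDERIV f x :> g x"
    and lip: "\<And>x y. norm (g x - g y) \<le> L * norm (x - y)"
  shows "f u \<ge> f y + g y \<bullet> (u - y) + (norm (g y - g u))\<^sup>2 / (2 * L)"
proof -
  define w where "w = g u - g y"
  \<comment> \<open>\<open>z\<close> minimises the quadratic upper model at \<open>u\<close> minus
    the tangent at \<open>y\<close>, that is, it is a gradient step of length 1/L from
    \<open>u\<close> for \<open>f\<close> minus the linear form given by \<open>g y\<close>.\<close>
  define z where "z = u - (1 / L) *\<^sub>R w"
  have "f z \<ge> f y + g y \<bullet> (z - y)"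
    by (rule convex_gradient_lower[OF conv grad])
  moreover have "f z \<le> f u + g u \<bullet> (z - u) + L / 2 * (norm (z - u))\<^sup>2"
    by (rule lipschitz_gradient_upper[OF grad lip])
  moreover have "g y \<bullet> (z - y) = g y \<bullet> (u - y) - (g y \<bullet> w) / L"
    by (simp add: z_def inner_diff_right algebra_simps)
  moreover have "g u \<bullet> (z - u) = - ((g y \<bullet> w) / L) - (norm w)\<^sup>2 / L"
    unfolding power2_norm_eq_inner using \<open>L > 0\<close>
    by (simp add: z_def w_def inner_diff_left inner_diff_right field_simps)
  moreover have "L / 2 * (norm (z - u))\<^sup>2 = (norm w)\<^sup>2 / (2 * L)"
    using \<open>L > 0\<close> by (simp add: z_def power_divide power2_eq_square)
  moreover have "(norm (g y - g u))\<^sup>2 / (2 * L) = (norm w)\<^sup>2 / (2 * L)"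
    by (simp add: w_def norm_minus_commute)
  moreover have "(norm w)\<^sup>2 / L = 2 * ((norm w)\<^sup>2 / (2 * L))" by simp
  ultimately show ?thesis by linarith
qed

section \<open>Drift of the inner iterates and the resulting gradient error\<close>

lemma nasg_inner_eq_sum:
  "nasg_inner g \<eta> p y i = y - (\<Sum>j=1..i. \<eta> j *\<^sub>R g (p j) (nasg_inner g \<eta> p y (j - 1)))"
  by (induction i) (simp_all add: algebra_simps)

text \<open>Strong induction. Gradients frozen at \<open>y\<close> move the iterate by at most
  \<open>h * M\<close>, with \<open>M\<close> the mean gradient norm at \<open>y\<close>; the
  Lipschitz correction adds at most \<open>h * L\<close> times the bound for earlier iterates. The
  constant 2 is reproduced because 1 + 2 * (1/2) = 2.\<close>

lemma nasg_inner_drift: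
  fixes g :: "nat \<Rightarrow> 'a::real_normed_vector \<Rightarrow> 'a"
  assumes "n \<ge> 1" "0 \<le> h" "h * L \<le> 1 / 2" "0 \<le> L" and perm: "p permutes {1..n}"
    and lip: "\<And>i x y. i \<in> {1..n} \<Longrightarrow> norm (g i x - g i y) \<le> L * norm (x - y)"
    and "i \<le> n"
  shows "norm (nasg_inner g (\<lambda>_. h / n) p y i - y) \<le> 2 * h * ((\<Sum>j=1..n. norm (g j y)) / n)"
  using \<open>i \<le> n\<close>
proof (induction i rule: less_induct)
  case (less i)
  define a where "a j = nasg_inner g (\<lambda>_. h / n) p y j" for j
  define M where "M = (\<Sum>j=1..n. norm (g j y)) / n"
  have M: "M \<ge> 0" by (simp add: M_def sum_nonneg)
  have "norm (a i - y) = norm (\<Sum>j=1..i. (h / n) *\<^sub>R g (p j) (a (j - 1)))"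
    unfolding a_def nasg_inner_eq_sum[of _ _ _ _ i] by (simp add: norm_minus_commute)
  also have "\<dots> \<le> (\<Sum>j=1..i. norm ((h / n) *\<^sub>R g (p j) (a (j - 1))))"
    by (rule norm_sum)
  also have "\<dots> \<le> (\<Sum>j=1..i. h / n * (norm (g (p j) y) + L * (2 * h * M)))"
  proof (rule sum_mono)
    fix j assume j: "j \<in> {1..i}"
    then have "p j \<in> {1..n}"
      using less.prems permutes_in_image[OF perm, of j] by auto
    then have "norm (g (p j) (a (j - 1)) - g (p j) y) \<le> L * norm (a (j - 1) - y)"
      by (rule lip)
    also have "\<dots> \<le> L * (2 * h * M)"
      using less.IH[of "j - 1"] less.prems j \<open>0 \<le> L\<close>
      unfolding a_def M_def by (intro mult_left_mono) auto
    finally have "norm (g (p j) (a (j - 1))) \<le> norm (g (p j) y) + L * (2 * h * M)"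
      using norm_triangle_sub[of "g (p j) (a (j - 1))" "g (p j) y"] by linarith
    then show "norm ((h / n) *\<^sub>R g (p j) (a (j - 1)))
        \<le> h / n * (norm (g (p j) y) + L * (2 * h * M))"
      using \<open>0 \<le> h\<close> by (auto intro!: divide_right_mono mult_left_mono)
  qed
  \<comment> \<open>Enlarging the prefix to the whole epoch makes the sum independent of the order
    of the components.\<close>
  also have "\<dots> \<le> (\<Sum>j=1..n. h / n * (norm (g (p j) y) + L * (2 * h * M)))"
    using less.prems \<open>0 \<le> h\<close> \<open>0 \<le> L\<close> M
    by (intro sum_mono2) auto
  also have "\<dots> = h / n * (\<Sum>j=1..n. norm (g (p j) y)) + (h * L) * (2 * h * M)"
    unfolding sum_distrib_left[symmetric] sum.distrib using \<open>n \<ge> 1\<close>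
    by (simp add: field_simps)
  also have "(\<Sum>j=1..n. norm (g (p j) y)) = n * M"
    using sum.permute[OF perm, of "\<lambda>j. norm (g j y)"] \<open>n \<ge> 1\<close>
    by (simp add: M_def o_def)
  also have "h / n * (n * M) + (h * L) * (2 * h * M) \<le> h * M + 1 / 2 * (2 * h * M)"
    using assms(1-3) M by (intro add_mono mult_right_mono) auto
  finally show ?case by (simp add: a_def M_def)
qed

lemma sum_squared_le_card_mult:
  fixes a :: "'b \<Rightarrow> real"
  shows "(\<Sum>i\<in>A. a i)\<^sup>2 \<le> card A * (\<Sum>i\<in>A. (a i)\<^sup>2)"
  using Cauchy_Schwarz_ineq_sum[of "\<lambda>_. 1" a A] by simp

text \<open>The displacement of an epoch divided by \<open>h\<close> is the mean of the component
  gradients at the inner iterates. As \<open>p\<close> is a bijection, it is compared with the full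
  gradient at \<open>y\<close> term by term, and the drift bound gives \<open>norm e\<close> \<le>
  \<open>2 * L * h * M\<close>. Splitting each gradient at \<open>u\<close> doubles the square,
  hence 8.\<close>

lemma nasg_inner_gradient_error:
  fixes g :: "nat \<Rightarrow> 'a::real_normed_vector \<Rightarrow> 'a"
  assumes "n \<ge> 1" "0 < h" "h * L \<le> 1 / 2" "0 \<le> L" and perm: "p permutes {1..n}"
    and lip: "\<And>i x y. i \<in> {1..n} \<Longrightarrow> norm (g i x - g i y) \<le> L * norm (x - y)"
    and e: "e = (1 / h) *\<^sub>R (y - nasg_inner g (\<lambda>_. h / n) p y n) - (1 / n) *\<^sub>R (\<Sum>j=1..n. g j y)"
  shows "(norm e)\<^sup>2 \<le> 8 * L\<^sup>2 * h\<^sup>2 *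
    ((\<Sum>j=1..n. (norm (g j u))\<^sup>2) / n + (\<Sum>j=1..n. (norm (g j y - g j u))\<^sup>2) / n)"
proof -
  define a where "a j = nasg_inner g (\<lambda>_. h / n) p y j" for j
  define M where "M = (\<Sum>j=1..n. norm (g j y)) / n"
  have M: "M \<ge> 0" by (simp add: M_def sum_nonneg)
  have "(1 / h) *\<^sub>R (y - a n) = (1 / n) *\<^sub>R (\<Sum>j=1..n. g (p j) (a (j - 1)))"
    unfolding a_def nasg_inner_eq_sum[of _ _ _ _ n] using \<open>0 < h\<close>
    by (simp add: scaleR_sum_right[symmetric])
  moreover have "(\<Sum>j=1..n. g j y) = (\<Sum>j=1..n. g (p j) y)"
    using sum.permute[OF perm, of "\<lambda>j. g j y"] by (simp add: o_def)
  ultimately have "e = (1 / n) *\<^sub>R (\<Sum>j=1..n. g (p j) (a (j - 1)) - g (p j) y)"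
    by (simp add: e a_def sum_subtractf scaleR_diff_right)
  then have "norm e \<le> (1 / n) * (\<Sum>j=1..n. norm (g (p j) (a (j - 1)) - g (p j) y))"
    by (simp add: norm_sum divide_right_mono)
  also have "\<dots> \<le> (1 / n) * (\<Sum>j=1..n. L * (2 * h * M))"
  proof (intro mult_left_mono sum_mono)
    fix j assume j: "j \<in> {1..n}"
    then have "p j \<in> {1..n}"
      using permutes_in_image[OF perm, of j] by auto
    then have "norm (g (p j) (a (j - 1)) - g (p j) y) \<le> L * norm (a (j - 1) - y)"
      by (rule lip)
    also have "\<dots> \<le> L * (2 * h * M)"
      using nasg_inner_drift[of n h L p g "j - 1" y] assms(1-4) lip perm j
      unfolding a_def M_def by (intro mult_left_mono) auto
    finally show "norm (g (p j) (a (j - 1)) - g (p j) y) \<le> L * (2 * h * M)" .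
  qed simp
  also have "\<dots> = 2 * L * h * M"
    using \<open>n \<ge> 1\<close> by simp
  finally have "(norm e)\<^sup>2 \<le> (2 * L * h * M)\<^sup>2"
    by (simp add: power_mono)
  then have e_le: "(norm e)\<^sup>2 \<le> 4 * L\<^sup>2 * h\<^sup>2 * M\<^sup>2"
    by (simp add: power_mult_distrib)
  have "M\<^sup>2 \<le> (\<Sum>j=1..n. (norm (g j y))\<^sup>2) / n"
    using sum_squared_le_card_mult[of "\<lambda>j. norm (g j y)" "{1..n}"] \<open>n \<ge> 1\<close>
    by (simp add: M_def power_divide field_simps power2_eq_square)
  also have "(\<Sum>j=1..n. (norm (g j y))\<^sup>2)
      \<le> (\<Sum>j=1..n. 2 * (norm (g j u))\<^sup>2 + 2 * (norm (g j y - g j u))\<^sup>2)"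
  proof (rule sum_mono)
    fix j
    have "(norm (g j y))\<^sup>2 \<le> (norm (g j u) + norm (g j y - g j u))\<^sup>2"
      by (intro power_mono norm_triangle_sub) simp
    also have "\<dots> \<le> 2 * (norm (g j u))\<^sup>2 + 2 * (norm (g j y - g j u))\<^sup>2"
      using zero_le_power2[of "norm (g j u) - norm (g j y - g j u)"]
      by (simp add: power2_eq_square algebra_simps)
    finally show "(norm (g j y))\<^sup>2 \<le> 2 * (norm (g j u))\<^sup>2 + 2 * (norm (g j y - g j u))\<^sup>2" .
  qed
  finally have "M\<^sup>2 \<le> 2 * ((\<Sum>j=1..n. (norm (g j u))\<^sup>2) / n
      + (\<Sum>j=1..n. (norm (g j y - g j u))\<^sup>2) / n)"
    unfolding sum.distrib sum_distrib_left[symmetric]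
    by (simp add: divide_right_mono add_divide_distrib)
  then have "4 * L\<^sup>2 * h\<^sup>2 * M\<^sup>2 \<le> 4 * L\<^sup>2 * h\<^sup>2 * (2 * ((\<Sum>j=1..n. (norm (g j u))\<^sup>2) / n
      + (\<Sum>j=1..n. (norm (g j y - g j u))\<^sup>2) / n))"
    by (rule mult_left_mono) simp
  with e_le show ?thesis by linarith
qed

section \<open>One epoch as an inexact Nesterov step\<close>

text \<open>Here \<open>r\<close> is the reciprocal of Nesterov's mixing weight, so \<open>v\<close> and \<open>v'\<close> are the
  auxiliary points before and after a step from \<open>y\<close> with the inexact gradient \<open>G + e\<close>.\<close>

lemma inexact_nesterov_step:
  fixes y :: "'a::real_inner"
  assumes "0 < h" "h * L \<le> 1" "r \<ge> 1"
    and upper: "Fx' \<le> Fy + G \<bullet> (x' - y) + L / 2 * (norm (x' - y))\<^sup>2"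
    and lower: "Fx \<ge> Fy + G \<bullet> (x - y)"
    and lower_min: "Fs \<ge> Fy + G \<bullet> (xs - y) + b"
    and step: "x' = y - h *\<^sub>R (G + e)"
    and y: "r *\<^sub>R y = (r - 1) *\<^sub>R x + v"
    and x': "r *\<^sub>R x' = (r - 1) *\<^sub>R x + v'"
  shows "h * r\<^sup>2 * (Fx' - Fs) + (norm (v' - xs))\<^sup>2 / 2
    \<le> h * (r * (r - 1)) * (Fx - Fs) + (norm (v - xs))\<^sup>2 / 2 - h * r * (e \<bullet> (v' - xs)) - h * r * b"
proof -
  \<comment> \<open>The upper bound at \<open>x'\<close> has weight \<open>r\<close>, the lower
    bounds at \<open>x\<close> and \<open>xs\<close> have weights \<open>r - 1\<close> and 1. With
    these weights the linear terms collapse to the inner product of \<open>G\<close> with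
    \<open>v' - xs\<close>.\<close>
  have "r * (Fx' - Fs) \<le> (r - 1) * (Fx - Fs) + G \<bullet> (v' - xs) + r * (L / 2 * (norm (x' - y))\<^sup>2) - b"
  proof -
    have "r * Fx' \<le> r * (Fy + G \<bullet> (x' - y) + L / 2 * (norm (x' - y))\<^sup>2)"
      using upper \<open>r \<ge> 1\<close> by (intro mult_left_mono) auto
    moreover have "(r - 1) * (Fy + G \<bullet> (x - y)) \<le> (r - 1) * Fx"
      using lower \<open>r \<ge> 1\<close> by (intro mult_left_mono) auto
    moreover have "G \<bullet> (v' - xs) = r * (G \<bullet> (x' - y)) - (r - 1) * (G \<bullet> (x - y)) - G \<bullet> (xs - y)"
    proof -
      have "v' - xs = r *\<^sub>R (x' - y) - (r - 1) *\<^sub>R (x - y) - (xs - y)"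
        using x' by (simp add: algebra_simps)
      then show ?thesis by (simp only: inner_diff_right inner_scaleR_right)
    qed
    ultimately show ?thesis using lower_min by (simp add: algebra_simps)
  qed
  from mult_left_mono[OF this, of "h * r"]
  have main: "h * r\<^sup>2 * (Fx' - Fs) \<le> h * (r * (r - 1)) * (Fx - Fs) + r * ((h *\<^sub>R G) \<bullet> (v' - xs))
      + (h * L) * (r\<^sup>2 * (norm (x' - y))\<^sup>2) / 2 - h * r * b"
    using assms(1,3) by (simp add: algebra_simps power2_eq_square)
  have "r\<^sup>2 * (norm (x' - y))\<^sup>2 = (norm (v' - v))\<^sup>2"
  proof -
    have "v' - v = r *\<^sub>R (x' - y)"
      unfolding scaleR_diff_right x' y by simp
    then show ?thesis by (simp add: power_mult_distrib)
  qed
  moreover have "r * ((h *\<^sub>R G) \<bullet> (v' - xs)) = (v - v') \<bullet> (v' - xs) - h * r * (e \<bullet> (v' - xs))"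
  proof -
    have hG: "h *\<^sub>R G = (y - x') - h *\<^sub>R e"
      using step by (simp add: algebra_simps)
    have vv: "v - v' = r *\<^sub>R (y - x')"
      unfolding scaleR_diff_right x' y by simp
    show ?thesis unfolding hG vv inner_diff_left[of "y - x'"] by (simp add: right_diff_distrib)
  qed
  \<comment> \<open>The three-point identity yields a negative half of the squared norm of
    \<open>v' - v\<close>, which pays for the smoothness term of \<open>main\<close> because
    \<open>h * L\<close> \<le> 1.\<close>
  moreover have "(v - v') \<bullet> (v' - xs) =
      (norm (v - xs))\<^sup>2 / 2 - (norm (v' - xs))\<^sup>2 / 2 - (norm (v' - v))\<^sup>2 / 2"
    unfolding power2_norm_eq_inner
    by (simp add: inner_diff_left inner_diff_right inner_commute field_simps)
  moreover have "(h * L) * (norm (v' - v))\<^sup>2 \<le> (norm (v' - v))\<^sup>2"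
    using mult_right_mono[OF \<open>h * L \<le> 1\<close>, of "(norm (v' - v))\<^sup>2"] by simp
  ultimately show ?thesis using main by simp
qed

lemma young_inner:
  fixes u w :: "'a::real_inner"
  assumes "c > 0"
  shows "- (u \<bullet> w) \<le> c / 2 * (norm u)\<^sup>2 + (norm w)\<^sup>2 / (2 * c)"
proof -
  have "0 \<le> (norm (c *\<^sub>R u + w))\<^sup>2 / (2 * c)"
    using assms by simp
  also have "\<dots> = c / 2 * (norm u)\<^sup>2 + (norm w)\<^sup>2 / (2 * c) + u \<bullet> w"
    unfolding power2_norm_eq_inner using assms
    by (simp add: inner_add_left inner_add_right inner_commute field_simps)
  finally show ?thesis by simp
qed

text \<open>The slack \<open>1 - 1 / N\<close> in front of the new distance pays for the gradient error by Young's
  inequality.\<close>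

lemma nasg_epoch_descent:
  fixes f :: "nat \<Rightarrow> 'a::real_inner \<Rightarrow> real"
  assumes "n \<ge> 1" "L > 0"
    and conv: "\<And>i. i \<in> {1..n} \<Longrightarrow> convex_on UNIV (f i)"
    and grad: "\<And>i x. i \<in> {1..n} \<Longrightarrow> GDERIV (f i) x :> g i x"
    and lip: "\<And>i x y. i \<in> {1..n} \<Longrightarrow> norm (g i x - g i y) \<le> L * norm (x - y)"
    and F: "F = (\<lambda>w. (1 / real n) * (\<Sum>i=1..n. f i w))"
    and perm: "p permutes {1..n}"
    and "0 < h" "h * L \<le> 1 / 2" "r \<ge> 1" "N > 0" and small: "8 * N * r * (h * L)^3 \<le> 1"
    and x'_def: "x' = nasg_inner g (\<lambda>_. h / n) p y n"
    and y: "r *\<^sub>R y = (r - 1) *\<^sub>R x + v"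
    and x': "r *\<^sub>R x' = (r - 1) *\<^sub>R x + v'"
  shows "h * r\<^sup>2 * (F x' - F xs) + (1 - 1 / N) * ((norm (v' - xs))\<^sup>2 / 2)
    \<le> h * (r * (r - 1)) * (F x - F xs) + (norm (v - xs))\<^sup>2 / 2
      + h * r\<^sup>2 * (4 * N * (h * L)^3 * ((\<Sum>j=1..n. (norm (g j xs))\<^sup>2) / n) / L)"
proof -
  define G where "G = (1 / n) *\<^sub>R (\<Sum>j=1..n. g j y)"
  define e where "e = (1 / h) *\<^sub>R (y - nasg_inner g (\<lambda>_. h / n) p y n) - (1 / n) *\<^sub>R (\<Sum>j=1..n. g j y)"
  define S where "S = (\<Sum>j=1..n. (norm (g j xs))\<^sup>2) / n"
  define B where "B = (\<Sum>j=1..n. (norm (g j y - g j xs))\<^sup>2) / n"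
  have B: "B \<ge> 0" by (simp add: B_def sum_nonneg)
  have upper: "F x' \<le> F y + G \<bullet> (x' - y) + L / 2 * (norm (x' - y))\<^sup>2"
  proof -
    have "(\<Sum>j=1..n. f j x') \<le> (\<Sum>j=1..n. f j y + g j y \<bullet> (x' - y) + L / 2 * (norm (x' - y))\<^sup>2)"
      by (intro sum_mono lipschitz_gradient_upper grad lip)
    from mult_left_mono[OF this, of "1 / n"] show ?thesis
      using \<open>n \<ge> 1\<close> by (simp add: F G_def sum.distrib inner_sum_left add_divide_distrib)
  qed
  have lower: "F x \<ge> F y + G \<bullet> (x - y)"
  proof -
    have "(\<Sum>j=1..n. f j y + g j y \<bullet> (x - y)) \<le> (\<Sum>j=1..n. f j x)"
      by (intro sum_mono convex_gradient_lower conv grad)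
    from mult_left_mono[OF this, of "1 / n"] show ?thesis
      by (simp add: F G_def sum.distrib inner_sum_left add_divide_distrib)
  qed
  \<comment> \<open>Only at \<open>xs\<close> is the co-coercive bound used instead of the plain
    tangent: its gain \<open>B / (2 * L)\<close> is what absorbs the part \<open>B\<close> of the
    gradient error.\<close>
  have lower_min: "F xs \<ge> F y + G \<bullet> (xs - y) + B / (2 * L)"
  proof -
    have "(\<Sum>j=1..n. f j y + g j y \<bullet> (xs - y) + (norm (g j y - g j xs))\<^sup>2 / (2 * L))
        \<le> (\<Sum>j=1..n. f j xs)"
      by (intro sum_mono convex_lipschitz_gradient_lower conv grad lip \<open>L > 0\<close>)
    from mult_left_mono[OF this, of "1 / n"] show ?thesis
      by (simp add: F G_def B_def sum.distrib inner_sum_left add_divide_distrib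
          sum_divide_distrib[symmetric] mult.commute)
  qed
  have step: "x' = y - h *\<^sub>R (G + e)"
    using \<open>0 < h\<close> by (simp add: x'_def G_def e_def)
  have hL: "h * L \<le> 1" using \<open>h * L \<le> 1 / 2\<close> by simp
  have main: "h * r\<^sup>2 * (F x' - F xs) + (norm (v' - xs))\<^sup>2 / 2
    \<le> h * (r * (r - 1)) * (F x - F xs) + (norm (v - xs))\<^sup>2 / 2 - h * r * (e \<bullet> (v' - xs))
      - h * r * (B / (2 * L))"
    by (rule inexact_nesterov_step[OF \<open>0 < h\<close> hL \<open>r \<ge> 1\<close> upper lower lower_min step y x'])
  have "- (h * r * (e \<bullet> (v' - xs)))
      \<le> N / 2 * (norm ((h * r) *\<^sub>R e))\<^sup>2 + (norm (v' - xs))\<^sup>2 / (2 * N)"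
    using young_inner[OF \<open>N > 0\<close>, of "(h * r) *\<^sub>R e" "v' - xs"] by simp
  also have "(norm ((h * r) *\<^sub>R e))\<^sup>2 = (h * r)\<^sup>2 * (norm e)\<^sup>2"
    by (simp add: power_mult_distrib)
  also have "N / 2 * ((h * r)\<^sup>2 * (norm e)\<^sup>2) \<le> N / 2 * ((h * r)\<^sup>2 * (8 * L\<^sup>2 * h\<^sup>2 * (S + B)))"
    using nasg_inner_gradient_error[OF \<open>n \<ge> 1\<close> \<open>0 < h\<close> \<open>h * L \<le> 1 / 2\<close> _ perm lip e_def, of xs]
      \<open>L > 0\<close> \<open>N > 0\<close> unfolding S_def B_def by (intro mult_left_mono) auto
  also have "\<dots> = h * r\<^sup>2 * (4 * N * (h * L)^3 * S / L) + (8 * N * r * (h * L)^3) * (h * r * (B / (2 * L)))"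
    using \<open>L > 0\<close> by (simp add: power2_eq_square power3_eq_cube field_simps)
  \<comment> \<open>The squared error has been split so that its \<open>B\<close> part is a multiple
    of the gain in \<open>main\<close>; \<open>small\<close> says that the factor is at most 1. Only
    the \<open>xs\<close> part survives.\<close>
  also have "(8 * N * r * (h * L)^3) * (h * r * (B / (2 * L))) \<le> 1 * (h * r * (B / (2 * L)))"
    using small B \<open>L > 0\<close> \<open>0 < h\<close> \<open>r \<ge> 1\<close> by (intro mult_right_mono) auto
  finally have "- (h * r * (e \<bullet> (v' - xs))) \<le> h * r\<^sup>2 * (4 * N * (h * L)^3 * S / L)
      + h * r * (B / (2 * L)) + (norm (v' - xs))\<^sup>2 / (2 * N)"
    by simp
  moreover have "(1 - 1 / N) * ((norm (v' - xs))\<^sup>2 / 2)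
      = (norm (v' - xs))\<^sup>2 / 2 - (norm (v' - xs))\<^sup>2 / (2 * N)"
    using \<open>N > 0\<close> by (simp add: field_simps)
  ultimately show ?thesis
    using main unfolding S_def[symmetric] by linarith
qed

theorem corollaryE2:
  fixes L E \<alpha> k \<sigma>sq :: real
    and n T :: nat
    and f :: "nat \<Rightarrow> real ^ 'd \<Rightarrow> real"
    and g :: "nat \<Rightarrow> real ^ 'd \<Rightarrow> real ^ 'd"
    and F :: "real ^ 'd \<Rightarrow> real"
    and x0 xs :: "real ^ 'd"
    and \<pi> :: "nat \<Rightarrow> nat \<Rightarrow> nat"
    and \<eta> \<gamma> :: "nat \<Rightarrow> real"
  assumes "L > 0" and "n \<ge> 1"
    and "\<And>i. i \<in> {1..n} \<Longrightarrow> convex_on UNIV (f i)"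
    and "\<And>i x. i \<in> {1..n} \<Longrightarrow> GDERIV (f i) x :> g i x"
    and "\<And>i x y. i \<in> {1..n} \<Longrightarrow> norm (g i x - g i y) \<le> L * norm (x - y)"
    and "F = (\<lambda>w. (1 / real n) * (\<Sum>i = 1..n. f i w))"
    and "E > 0"
    and "\<And>w. F xs \<le> F w"
    and "norm (x0 - xs) \<le> E / sqrt (real n)"
    and "\<sigma>sq = (1 / real n) * (\<Sum>i = 1..n. (norm (g i xs))\<^sup>2)"
    and "T \<ge> 2"
    and "\<alpha> = 1 + 1 / real T"
    and "k = 1 / (exp 1 * \<alpha> * real n powr (1 / 4) * root 3 12)"
    and "\<And>t. t \<in> {1..T} \<Longrightarrow> \<pi> t permutes {1..n}"
    and "\<And>t. t \<in> {1..T} \<Longrightarrow> \<gamma> t = (real t - 1) / (real t + 2)"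
    and "\<And>t. t \<in> {1..T} \<Longrightarrow> \<eta> t = k * \<alpha> ^ t / (L * real T)"
  shows "(\<forall>t\<in>{1..T}. \<eta> t / real n > 0 \<and> \<eta> t \<le> 1 / L) \<and>
    F (nasg_x n g \<gamma> (\<lambda>t i. \<eta> t / real n) \<pi> x0 x0 T) - F xs
      \<le> 4 * \<sigma>sq / (9 * L * real n powr (3 / 4) * real T)
         + 2 * L * E\<^sup>2 * exp 1 * root 3 12 / (real n powr (3 / 4) * real T)"
proof -

  \<comment> \<open>Constants and step-size bounds\<close>
  note perm = assms(14) and \<gamma> = assms(15) and \<eta> = assms(16)
  define a where "a = real n powr (1 / 4)"
  define b where "b = real n powr (3 / 4)"
  define c where "c = root 3 12"
  have a1: "a \<ge> 1" and b0: "b > 0"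
    using \<open>n \<ge> 1\<close> by (auto simp: a_def b_def ge_one_powr_ge_zero)
  have a3: "a ^ 3 = b"
    by (simp add: a_def b_def power3_eq_cube powr_add[symmetric])
  have ab: "a * b = n"
    using \<open>n \<ge> 1\<close> by (simp add: a_def b_def powr_add[symmetric])
  have c1: "c \<ge> 1" and c3: "c ^ 3 = 12"
    by (simp_all add: c_def)
  have T0: "real T > 0" using \<open>T \<ge> 2\<close> by simp
  have \<alpha>1: "\<alpha> > 1" using T0 assms(12) by simp
  have \<alpha>T: "\<alpha> * T = T + 1" using T0 assms(12) by (simp add: field_simps)
  have k: "k = 1 / (exp 1 * \<alpha> * a * c)" by (simp add: assms(13) a_def c_def)
  have k0: "k > 0" using \<alpha>1 a1 c1 by (simp add: k)
  have pow_le: "\<alpha> ^ t \<le> exp 1" if "t \<le> T" for t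
  proof -
    have "\<alpha> ^ t \<le> \<alpha> ^ T" using that \<alpha>1 by (simp add: power_increasing)
    also have "\<dots> \<le> exp (1 / T) ^ T"
      unfolding assms(12) by (intro power_mono exp_ge_add_one_self) simp
    also have "\<dots> = exp 1" using T0 by (simp add: exp_of_nat_mult[symmetric])
    finally show ?thesis .
  qed
  have \<eta>0: "\<eta> t > 0" if "t \<in> {1..T}" for t
    using that \<eta> k0 \<alpha>1 T0 \<open>L > 0\<close> by simp
  \<comment> \<open>In \<open>k\<close>, the factor \<open>exp 1\<close> cancels the bound on
    \<alpha>^t, and \<alpha> turns T into T + 1.\<close>
  have \<eta>L: "\<eta> t * L \<le> 1 / ((T + 1) * a * c)" if "t \<in> {1..T}" for t
  proof -
    have "\<eta> t * L = k * \<alpha> ^ t / T" using \<eta>[OF that] \<open>L > 0\<close> by simp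
    also have "\<dots> \<le> k * exp 1 / T"
      using pow_le that k0 by (intro divide_right_mono mult_left_mono) auto
    also have "\<dots> = 1 / ((\<alpha> * T) * a * c)" by (simp add: k mult_ac)
    finally show ?thesis by (simp add: \<alpha>T)
  qed
  have ac: "a * c \<ge> 1" using mult_mono[OF a1 c1] a1 by simp
  have \<eta>L_half: "\<eta> t * L \<le> 1 / 2" if "t \<in> {1..T}" for t
  proof -
    have "2 * 1 \<le> (real T + 1) * (a * c)"
      using \<open>T \<ge> 2\<close> ac by (intro mult_mono) auto
    then have "1 / ((real T + 1) * a * c) \<le> 1 / 2"
      using a1 c1 by (intro divide_left_mono) (auto simp: mult.assoc intro!: mult_pos_pos)
    with \<eta>L[OF that] show ?thesis by (simp add: add.commute)
  qed
  \<comment> \<open>The error per epoch is cubic in the step size: cubing turns n^(1/4) into n^(3/4)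
    and the cube root into 12.\<close>
  have \<eta>L3: "(\<eta> t * L) ^ 3 \<le> 1 / (12 * b * (T + 1) ^ 3)" if "t \<in> {1..T}" for t
  proof -
    have "(\<eta> t * L) ^ 3 \<le> (1 / ((T + 1) * a * c)) ^ 3"
      using \<eta>L[OF that] \<eta>0[OF that] \<open>L > 0\<close> by (intro power_mono) auto
    also have "\<dots> = 1 / (c ^ 3 * a ^ 3 * (T + 1) ^ 3)"
      by (simp add: power_divide power_mult_distrib mult_ac)
    finally show ?thesis by (simp add: a3 c3)
  qed

  \<comment> \<open>Outer iterates and the auxiliary Nesterov point\<close>
  define x where "x t = fst (nasg n g \<gamma> (\<lambda>t i. \<eta> t / real n) \<pi> x0 x0 t)" for t
  define y where "y t = snd (nasg n g \<gamma> (\<lambda>t i. \<eta> t / real n) \<pi> x0 x0 t)" for t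
  \<comment> \<open>\<open>v\<close> is chosen so that \<open>x_mix\<close> holds with
    \<open>r\<close> = (t + 2)/2. The value at 0 is \<open>x0\<close> because there \<open>r\<close>
    = 1 and both outer iterates equal \<open>x0\<close>.\<close>
  define v where "v t = (case t of 0 \<Rightarrow> x0 | Suc s \<Rightarrow> x s + ((real s + 2) / 2) *\<^sub>R (x (Suc s) - x s))" for t
  have x_Suc: "x (Suc t) = nasg_inner g (\<lambda>_. \<eta> (Suc t) / n) (\<pi> (Suc t)) (y t) n" for t
    by (simp add: x_def y_def Let_def split_beta)
  have y_Suc: "y (Suc t) = x (Suc t) + \<gamma> (Suc t) *\<^sub>R (x (Suc t) - x t)" for t
    by (simp add: x_def y_def Let_def split_beta)
  \<comment> \<open>Here the momentum schedule enters: for t = s + 1 the product of \<open>r\<close>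
    = (s + 3)/2 and \<gamma> = s/(s + 3) is s/2, exactly the multiple of the last displacement that
    \<open>v\<close> requires.\<close>
  have y_mix: "((real t + 2) / 2) *\<^sub>R y t = ((real t + 2) / 2 - 1) *\<^sub>R x t + v t" if "t < T" for t
  proof (cases t)
    case 0
    then show ?thesis by (simp add: v_def y_def)
  next
    case (Suc s)
    have "((real s + 3) / 2) *\<^sub>R y (Suc s) = ((real s + 3) / 2) *\<^sub>R x (Suc s)
        + ((real s + 3) / 2 * (real s / (real s + 3))) *\<^sub>R (x (Suc s) - x s)"
      using that Suc \<gamma>[of "Suc s"] by (simp add: y_Suc scaleR_add_right add.commute)
    also have "(real s + 3) / 2 * (real s / (real s + 3)) = real s / 2"
      by (simp add: field_simps)
    also have "((real s + 3) / 2) *\<^sub>R x (Suc s) + (real s / 2) *\<^sub>R (x (Suc s) - x s)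
        = ((real s + 3) / 2 - 1) *\<^sub>R x (Suc s) + v (Suc s)"
      by (simp add: v_def vec_eq_iff field_simps)
    finally show ?thesis by (simp add: Suc add.commute)
  qed
  have x_mix: "((real t + 2) / 2) *\<^sub>R x (Suc t) = ((real t + 2) / 2 - 1) *\<^sub>R x t + v (Suc t)" for t
    by (simp add: v_def vec_eq_iff field_simps)

  \<comment> \<open>The weighted potential and its telescoping\<close>
  define q where "q = k * \<alpha> / (L * T)"
  \<comment> \<open>\<open>C\<close> is the error factor 4 N (hL)^3 \<sigma>sq / L of an epoch with
    N = T + 1 and the cubic step-size bound inserted; 4/12 gives the 1/3. Since
    \<open>\<eta> (Suc t)\<close> is \<open>q * \<alpha> ^ t\<close>, dividing by \<alpha>^t leaves
    the constant step \<open>q\<close>.\<close>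
  define C where "C = \<sigma>sq / (3 * L * b * (real T + 1)\<^sup>2)"
  define W where "W t = (norm (v t - xs))\<^sup>2 / 2 / \<alpha> ^ t" for t
  define \<delta> where "\<delta> t = F (x t) - F xs" for t
  have q0: "q > 0" using k0 \<alpha>1 T0 \<open>L > 0\<close> by (simp add: q_def)
  have \<sigma>0: "\<sigma>sq \<ge> 0" by (simp add: assms(10) sum_nonneg)
  have C0: "C \<ge> 0" using \<sigma>0 \<open>L > 0\<close> b0 by (simp add: C_def)
  have W0: "W t \<ge> 0" for t using \<alpha>1 by (simp add: W_def)
  have \<delta>0: "\<delta> t \<ge> 0" for t using assms(8) by (simp add: \<delta>_def)

  \<comment> \<open>The weight \<open>t (t + 2) / 4\<close> replaces Nesterov's \<open>((t + 1) / 2)\<^sup>2\<close>, so that the initial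
    function value does not enter.\<close>
  have descent: "q * ((real t + 2) / 2)\<^sup>2 * \<delta> (Suc t) + W (Suc t)
      \<le> q * (real t * (real t + 2) / 4) * \<delta> t + W t + q * ((real t + 2) / 2)\<^sup>2 * C"
    if "t < T" for t
  proof -
    define r where "r = (real t + 2) / 2"
    define h where "h = \<eta> (Suc t)"
    \<comment> \<open>This Young parameter makes 1 - 1/N equal to 1/\<alpha>, so the loss in the
      distance term is one step of the normalisation in \<open>W\<close>.\<close>
    define N where "N = real T + 1"
    have t: "Suc t \<in> {1..T}" using that by simp
    have r: "r \<ge> 1" "r \<le> N / 2" using that by (auto simp: r_def N_def)
    have N: "N \<ge> 3" using \<open>T \<ge> 2\<close> by (simp add: N_def)
    have h0: "h > 0" using \<eta>0[OF t] by (simp add: h_def)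
    have h3: "(h * L) ^ 3 \<le> 1 / (12 * b * N ^ 3)"
      using \<eta>L3[OF t] by (simp add: h_def N_def add.commute)
    have b1: "b \<ge> 1" using a1 a3 one_le_power by metis
    have small: "8 * N * r * (h * L) ^ 3 \<le> 1"
    proof -
      have "8 * N * r * (h * L) ^ 3 \<le> 8 * N * (N / 2) * (1 / (12 * b * N ^ 3))"
        using r N h3 h0 \<open>L > 0\<close> by (intro mult_mono) auto
      also have "\<dots> = 1 / (3 * b * N)"
        using N b0 by (simp add: field_simps power3_eq_cube)
      also have "\<dots> \<le> 1"
        using mult_mono[of 1 "3 * b" 1 N] N b1 by simp
      finally show ?thesis .
    qed
    have \<sigma>: "\<sigma>sq = (\<Sum>j=1..n. (norm (g j xs))\<^sup>2) / n" by (simp add: assms(10))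
    have "h * r\<^sup>2 * \<delta> (Suc t) + (1 - 1 / N) * ((norm (v (Suc t) - xs))\<^sup>2 / 2)
        \<le> h * (r * (r - 1)) * \<delta> t + (norm (v t - xs))\<^sup>2 / 2
          + h * r\<^sup>2 * (4 * N * (h * L)^3 * \<sigma>sq / L)"
      unfolding \<delta>_def h_def r_def \<sigma>
      using small \<eta>0[OF t] \<eta>L_half[OF t] N r perm[OF t] x_Suc[of t] y_mix[OF that] x_mix[of t]
      unfolding h_def r_def
      by (intro nasg_epoch_descent[OF \<open>n \<ge> 1\<close> \<open>L > 0\<close> assms(3-6), where y = "y t"]) auto
    moreover have "h * r\<^sup>2 * (4 * N * (h * L)^3 * \<sigma>sq / L) \<le> h * r\<^sup>2 * C"
    proof -
      have "4 * N * (h * L)^3 * \<sigma>sq / L \<le> 4 * N * (1 / (12 * b * N ^ 3)) * \<sigma>sq / L"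
        using h3 N \<sigma>0 \<open>L > 0\<close> by (intro divide_right_mono mult_right_mono mult_left_mono) auto
      also have "\<dots> = C"
        using N b0 \<open>L > 0\<close> unfolding C_def N_def[symmetric]
        by (simp add: field_simps power3_eq_cube power2_eq_square)
      finally show ?thesis using h0 by (intro mult_left_mono) auto
    qed
    ultimately have epoch: "h * r\<^sup>2 * \<delta> (Suc t) + (1 - 1 / N) * ((norm (v (Suc t) - xs))\<^sup>2 / 2)
        \<le> h * (r * (r - 1)) * \<delta> t + (norm (v t - xs))\<^sup>2 / 2 + h * r\<^sup>2 * C"
      by linarith
    have W_Suc: "(1 - 1 / N) * ((norm (v (Suc t) - xs))\<^sup>2 / 2) = W (Suc t) * \<alpha> ^ t"
    proof -
      have "1 - 1 / N = 1 / \<alpha>"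
        using T0 by (simp add: N_def assms(12) field_simps)
      then show ?thesis using \<alpha>1 by (simp add: W_def)
    qed
    have W_t: "(norm (v t - xs))\<^sup>2 / 2 = W t * \<alpha> ^ t"
      using \<alpha>1 by (simp add: W_def)
    have h: "h = q * \<alpha> ^ t"
      using \<eta>[OF t] by (simp add: h_def q_def)
    have "(q * r\<^sup>2 * \<delta> (Suc t) + W (Suc t)) * \<alpha> ^ t
        \<le> (q * (r * (r - 1)) * \<delta> t + W t + q * r\<^sup>2 * C) * \<alpha> ^ t"
      using epoch unfolding W_Suc W_t unfolding h by (simp add: algebra_simps)
    then have "q * r\<^sup>2 * \<delta> (Suc t) + W (Suc t) \<le> q * (r * (r - 1)) * \<delta> t + W t + q * r\<^sup>2 * C"
      using \<alpha>1 by simp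
    moreover have "r * (r - 1) = real t * (real t + 2) / 4"
      by (simp add: r_def field_simps)
    ultimately show ?thesis by (simp only: r_def[symmetric])
  qed

  have potential: "q * (real t * (real t + 2) / 4) * \<delta> t + W t \<le> W 0 + t * (q * ((real T + 1) / 2)\<^sup>2 * C)"
    if "t \<le> T" for t
    using that
  proof (induction t)
    case (Suc t)
    \<comment> \<open>Since (t + 1)(t + 3) = (t + 2)^2 - 1, the weight the next epoch needs is at
      most the weight just obtained. The errors are bounded uniformly through t + 2 \<le> T +
      1.\<close>
    have "q * (real (Suc t) * (real (Suc t) + 2) / 4) * \<delta> (Suc t) \<le> q * ((real t + 2) / 2)\<^sup>2 * \<delta> (Suc t)"
      using q0 \<delta>0 by (intro mult_right_mono mult_left_mono) (auto simp: power2_eq_square field_simps)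
    moreover have "q * ((real t + 2) / 2)\<^sup>2 * C \<le> q * ((real T + 1) / 2)\<^sup>2 * C"
      using q0 C0 Suc.prems by (intro mult_right_mono mult_left_mono power_mono) auto
    ultimately have "q * (real (Suc t) * (real (Suc t) + 2) / 4) * \<delta> (Suc t) + W (Suc t)
        \<le> W 0 + t * (q * ((real T + 1) / 2)\<^sup>2 * C) + q * ((real T + 1) / 2)\<^sup>2 * C"
      using Suc.IH descent[of t] Suc.prems by linarith
    then show ?case by (simp add: distrib_right)
  qed simp
  have W_0: "W 0 \<le> E\<^sup>2 / (2 * n)"
  proof -
    have "(norm (x0 - xs))\<^sup>2 \<le> (E / sqrt n)\<^sup>2" using assms(9) by (intro power_mono) auto
    then show ?thesis by (simp add: W_def v_def power_divide)
  qed

  \<comment> \<open>The final rate\<close>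
  define R where "R = real T * (real T + 2)"
  have R: "R > 0" "(real T)\<^sup>2 \<le> R"
    using T0 by (auto simp: R_def power2_eq_square)
  have "q * (R / 4) * \<delta> T \<le> E\<^sup>2 / (2 * n) + T * (q * ((real T + 1) / 2)\<^sup>2 * C)"
    using potential[of T] W0[of T] W_0 by (simp add: R_def)
  then have "\<delta> T \<le> (E\<^sup>2 / (2 * n) + T * (q * ((real T + 1) / 2)\<^sup>2 * C)) / (q * (R / 4))"
    using q0 R by (simp add: pos_le_divide_eq mult.commute)
  also have "\<dots> = 2 * E\<^sup>2 / (n * q * R) + (real T + 1)\<^sup>2 * C * T / R"
    using q0 R \<open>n \<ge> 1\<close> by (simp add: field_simps power2_eq_square)
  also have "2 * E\<^sup>2 / (n * q * R) \<le> 2 * E\<^sup>2 / (n * q * (real T)\<^sup>2)"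
    using q0 R T0 \<open>n \<ge> 1\<close> by (intro divide_left_mono mult_left_mono) auto
  \<comment> \<open>With n = \<open>a * b\<close>, the factor \<open>a\<close> from
    1/\<open>q\<close> cancels against n, leaving \<open>b\<close> = n^(3/4); the \<alpha> in
    \<open>q\<close> cancels the one in \<open>k\<close>.\<close>
  also have "\<dots> = 2 * L * E\<^sup>2 * exp 1 * c / (b * T)"
    unfolding ab[symmetric] q_def k using \<alpha>1 a1 c1 b0 T0 \<open>L > 0\<close>
    by (simp add: field_simps power2_eq_square)
  also have "(real T + 1)\<^sup>2 * C * T / R = \<sigma>sq / (3 * L * b * (T + 2))"
  proof -
    have "(real T + 1)\<^sup>2 * C = \<sigma>sq / (3 * L * b)"
      using T0 by (simp add: C_def)
    then show ?thesis using T0 by (simp add: R_def add.commute)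
  qed
  \<comment> \<open>T + 2 is bounded below by T, and 1/3 is relaxed to the claimed 4/9.\<close>
  also have "\<sigma>sq / (3 * L * b * (T + 2)) \<le> 4 * \<sigma>sq / (9 * L * b * T)"
  proof -
    have "\<sigma>sq / (3 * L * b * (T + 2)) \<le> \<sigma>sq / (9 / 4 * L * b * T)"
      using \<sigma>0 \<open>L > 0\<close> b0 T0 by (intro divide_left_mono mult_mono) auto
    then show ?thesis by simp
  qed
  finally have "\<delta> T \<le> 4 * \<sigma>sq / (9 * L * b * T) + 2 * L * E\<^sup>2 * exp 1 * c / (b * T)"
    by simp
  moreover have "\<eta> t / n > 0 \<and> \<eta> t \<le> 1 / L" if "t \<in> {1..T}" for t
    using \<eta>0[OF that] \<eta>L_half[OF that] \<open>n \<ge> 1\<close> \<open>L > 0\<close> by (simp add: pos_le_divide_eq)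
  ultimately show ?thesis
    by (simp add: \<delta>_def x_def nasg_x_def b_def c_def)
qed

end
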